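(* Let $m \geq 2$ and $n \geq 0$. Then $$H_{n+1}(t_1, \ldots, t_{m-1}) = \sum_{i = 0}^{m-1} \mathbf{e}_{i+1}(t_1, \ldots, t_{m-1}, 1)\, (-1)^{i}\, \frac{(q)_n}{(q)_{n-i}}\, H_{n-i}(t_1, \ldots, t_{m-1}),$$ where $\mathbf{e}_{j}(t_1,\ldots,t_{m-1},1)$ denotes the $j$-th elementary symmetric polynomial in the $m$ quantities $t_1,\ldots,t_{m-1},1$, and where $(-1)^i\frac{(q)_n}{(q)_{n-i}}$ means $(q^n-1)(q^{n-1}-1)\cdots(q^{n-i+1}-1)$, so that the terms with $i>n$ vanish.
   Context: Let $q \neq 1$ be a parameter (e.g. an indeterminate). For $n \geq 1$ put $(q)_n = (1-q)(1-q^2)\cdots(1-q^n)$, and $(q)_0 = 1$. For non-negative integers $k_1,\ldots,k_m$ with $k_1+\cdots+k_m = n$, the $q$-multinomial coefficient is $\binom{n}{k_1,\ldots,k_m}_q = \frac{(q)_n}{(q)_{k_1}\cdots(q)_{k_m}}$. For $m \geq 2$, the Rogers–Szegő polynomial in $m-1$ variables is $$H_n(t_1,\ldots,t_{m-1}) = \sum_{k_1+\cdots+k_m = n} \binom{n}{k_1,\ldots,k_m}_q t_1^{k_1}\cdots t_{m-1}^{k_{m-1}},$$ the sum over all $m$-tuples of non-negative integers summing to $n$. *)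

theory Defs
  imports Complex_Main "HOL-Library.FuncSet" "HOL-Library.Poly_Mapping"
begin

text \<open>
  Multivariate polynomials over a coefficient type \<open>'a\<close> are finitely supported maps from monomials
  to coefficients, where a monomial is a finitely supported map from variable indices to exponents.
  The variables are indexed by \<open>nat\<close>; the Rogers--Szego polynomials use those with
  indices \<open>1, \<dots>, m - 1\<close>.
\<close>

type_synonym 'a mpol = "(nat \<Rightarrow>\<^sub>0 nat) \<Rightarrow>\<^sub>0 'a"

definition mconst :: "'a::zero \<Rightarrow> 'a mpol" where
  "mconst c = Poly_Mapping.single 0 c"

definition mvar :: "nat \<Rightarrow> 'a::zero_neq_one mpol" where
  "mvar i = Poly_Mapping.single (Poly_Mapping.single i 1) 1"

definition qpoch :: "'a::field \<Rightarrow> nat \<Rightarrow> 'a" where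
  "qpoch q n = (\<Prod>j=1..n. 1 - q ^ j)"

text \<open>The \<open>m\<close>-tuple \<open>k\<^sub>1, \<dots>, k\<^sub>m\<close> is \<open>k 1, \<dots>, k m\<close>. The quotient is the intended one only if
  \<open>q ^ j \<noteq> 1\<close> for \<open>1 \<le> j \<le> n\<close>, since division by zero yields \<open>0\<close>.\<close>

definition qmultinomial :: "'a::field \<Rightarrow> nat \<Rightarrow> nat \<Rightarrow> (nat \<Rightarrow> nat) \<Rightarrow> 'a" where
  "qmultinomial q m n k = qpoch q n / (\<Prod>i=1..m. qpoch q (k i))"

text \<open>Tuples are extensional functions, so each one is counted once.\<close>

definition tuples :: "nat \<Rightarrow> nat \<Rightarrow> (nat \<Rightarrow> nat) set" where
  "tuples m n = {k \<in> {1..m} \<rightarrow>\<^sub>E UNIV. (\<Sum>i=1..m. k i) = n}"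

lemma finite_tuples: "finite (tuples m n)"
proof (rule finite_subset)
  show "tuples m n \<subseteq> {1..m} \<rightarrow>\<^sub>E {..n}"
    unfolding tuples_def by (auto simp: PiE_iff extensional_def intro: member_le_sum)
  show "finite ({1..m} \<rightarrow>\<^sub>E {..n})"
    by (rule finite_PiE) auto
qed

definition rogers_szego :: "'a::field \<Rightarrow> nat \<Rightarrow> nat \<Rightarrow> 'a mpol" where
  "rogers_szego q m n =
     (\<Sum>k\<in>tuples m n. mconst (qmultinomial q m n k) * (\<Prod>i=1..m-1. mvar i ^ k i))"

text \<open>The \<open>j\<close>-th elementary symmetric polynomial in the \<open>m\<close> quantities \<open>x 1, \<dots>, x m\<close>.\<close>

definition esym :: "nat \<Rightarrow> nat \<Rightarrow> (nat \<Rightarrow> 'b::comm_ring_1) \<Rightarrow> 'b" where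
  "esym j m x = (\<Sum>S | S \<subseteq> {1..m} \<and> card S = j. \<Prod>i\<in>S. x i)"

text \<open>The product \<open>(q\<^sup>n - 1) (q\<^sup>n\<^sup>-\<^sup>1 - 1) \<dots> (q\<^sup>n\<^sup>-\<^sup>i\<^sup>+\<^sup>1 - 1)\<close>. The two lemmas below relate it
  to \<open>(-1)\<^sup>i (q)\<^sub>n / (q)\<^sub>n\<^sub>-\<^sub>i\<close>; the truncated subtraction is harmless, since for \<open>i > n\<close>
  the factor with \<open>j = n\<close> is \<open>0\<close>.\<close>

definition qfall :: "'a::field \<Rightarrow> nat \<Rightarrow> nat \<Rightarrow> 'a" where
  "qfall q n i = (\<Prod>j<i. q ^ (n - j) - 1)"

lemma qfall_eq_0: "i > n \<Longrightarrow> qfall q n i = 0"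
  unfolding qfall_def by (rule prod_zero) (auto intro: bexI[of _ n])

lemma qfall_eq_quotient:
  assumes "i \<le> n" and "qpoch q (n - i) \<noteq> 0"
  shows "qfall q n i = (-1) ^ i * qpoch q n / qpoch q (n - i)"
proof -
  have "qfall q n i * qpoch q (n - i) = (-1) ^ i * qpoch q n" using assms(1)
  proof (induction i)
    case 0
    show ?case by (simp add: qfall_def)
  next
    case (Suc i)
    then have *: "n - i = Suc (n - Suc i)" by simp
    have "qpoch q (n - i) = qpoch q (n - Suc i) * (1 - q ^ (n - i))"
      unfolding * by (simp add: qpoch_def)
    moreover have "qfall q n (Suc i) = qfall q n i * (q ^ (n - i) - 1)"
      by (simp add: qfall_def)
    ultimately have "qfall q n (Suc i) * qpoch q (n - Suc i) = - (qfall q n i * qpoch q (n - i))"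
      by (simp only:) (simp add: algebra_simps)
    with Suc show ?case by simp
  qed
  with assms(2) show ?thesis by (simp add: field_simps)
qed

end

theory Submission
  imports Defs "HOL-Computational_Algebra.Formal_Power_Series"
begin

text \<open>
  Put \<open>G\<^sub>n = H\<^sub>n / (q)\<^sub>n\<close>. Then \<open>G\<^sub>n\<close> is the coefficient of \<open>X\<^sup>n\<close> in the product of the \<open>q\<close>-exponentials
  \<open>E(t\<^sub>l X)\<close> with \<open>l = 1, \<dots>, m\<close> and \<open>t\<^sub>m = 1\<close>, where \<open>E(z)\<close> is the sum of the \<open>z\<^sup>k / (q)\<^sub>k\<close>.
  As \<open>E(q z) = (1 - z) E(z)\<close>, replacing \<open>X\<close> by \<open>q X\<close> multiplies this product by
  the product of the \<open>1 - t\<^sub>l X\<close>, whose coefficients are the signed elementary symmetric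
  polynomials. Comparing coefficients of \<open>X\<^sup>n\<^sup>+\<^sup>1\<close> gives the recurrence. Since \<open>q\<close> may be a root of
  unity of order greater than \<open>n + 1\<close>, the identities for power series are only claimed
  up to degree \<open>n + 1\<close>.
\<close>

text \<open>Congruence modulo the ideal generated by \<open>fps_X ^ (N + 1)\<close>, hence
  compatible with products.\<close>

definition fps_agree :: "nat \<Rightarrow> 'a fps \<Rightarrow> 'a fps \<Rightarrow> bool" where
  "fps_agree N f g \<longleftrightarrow> (\<forall>n\<le>N. fps_nth f n = fps_nth g n)"

lemma fps_agree_mult:
  fixes f g :: "'a::comm_ring_1 fps"
  assumes "fps_agree N f f'" "fps_agree N g g'"
  shows "fps_agree N (f * g) (f' * g')"
  using assms by (auto simp: fps_agree_def fps_mult_nth intro!: sum.cong)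

lemma fps_agree_prod:
  fixes f g :: "'i \<Rightarrow> 'a::comm_ring_1 fps"
  assumes "\<And>i. i \<in> A \<Longrightarrow> fps_agree N (f i) (g i)"
  shows "fps_agree N (\<Prod>i\<in>A. f i) (\<Prod>i\<in>A. g i)"
  using assms
proof (induction A rule: infinite_finite_induct)
  case (insert a A)
  then show ?case by (simp add: fps_agree_mult)
qed (auto simp: fps_agree_def)

text \<open>The substitution of \<open>r\<close> times X for X, given on coefficients.\<close>

definition fps_scale :: "'a::comm_ring_1 \<Rightarrow> 'a fps \<Rightarrow> 'a fps" where
  "fps_scale r f = Abs_fps (\<lambda>n. r ^ n * fps_nth f n)"

lemma fps_scale_nth [simp]: "fps_nth (fps_scale r f) n = r ^ n * fps_nth f n"
  by (simp add: fps_scale_def)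

lemma fps_scale_one [simp]: "fps_scale r 1 = 1"
  by (rule fps_ext) simp

lemma fps_scale_mult: "fps_scale r (f * g) = fps_scale r f * fps_scale r g"
proof (rule fps_ext)
  fix n
  have "r ^ n * (fps_nth f i * fps_nth g (n - i))
      = (r ^ i * fps_nth f i) * (r ^ (n - i) * fps_nth g (n - i))"
    if "i \<le> n" for i
  proof -
    have "r ^ n = r ^ i * r ^ (n - i)" using that by (simp flip: power_add)
    then show ?thesis by (simp add: mult_ac)
  qed
  then show "fps_nth (fps_scale r (f * g)) n = fps_nth (fps_scale r f * fps_scale r g) n"
    by (simp add: fps_mult_nth sum_distrib_left)
qed

lemma fps_scale_prod: "fps_scale r (\<Prod>i\<in>A. f i) = (\<Prod>i\<in>A. fps_scale r (f i))"
  by (induction A rule: infinite_finite_induct) (simp_all add: fps_scale_mult)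

text \<open>Splits off the last entry. The inverse resets position \<open>Suc m\<close> to
  \<open>undefined\<close>, which keeps the shortened tuple extensional.\<close>

lemma bij_betw_tuples_Suc:
  "bij_betw (\<lambda>(j, k). k(Suc m := j)) (SIGMA j:{..n}. tuples m (n - j)) (tuples (Suc m) n)"
proof (rule bij_betwI[where g = "\<lambda>k. (k (Suc m), k(Suc m := undefined))"])
  have less: "(\<Sum>i=1..m. if i = Suc m then j else k i) = (\<Sum>i=1..m. k i)" for j and k :: "nat \<Rightarrow> nat"
    by (rule sum.cong) auto
  show "(\<lambda>(j, k). k(Suc m := j)) \<in> (SIGMA j:{..n}. tuples m (n - j)) \<rightarrow> tuples (Suc m) n"
    by (auto simp: tuples_def PiE_iff extensional_def fun_upd_def less)
  show "(\<lambda>k. (k (Suc m), k(Suc m := undefined))) \<in> tuples (Suc m) n \<rightarrow> (SIGMA j:{..n}. tuples m (n - j))"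
    by (auto simp: tuples_def PiE_iff extensional_def fun_upd_def less)
qed (auto simp: tuples_def PiE_iff extensional_def fun_eq_iff)

text \<open>Iterated Cauchy product: the last factor contributes degree \<open>j\<close>, and the
  remaining ones share \<open>n - j\<close>.\<close>

lemma fps_nth_prod_tuples:
  fixes f :: "nat \<Rightarrow> 'a::comm_ring_1 fps"
  shows "fps_nth (\<Prod>i=1..m. f i) n = (\<Sum>k\<in>tuples m n. \<Prod>i=1..m. fps_nth (f i) (k i))"
proof (induction m arbitrary: n)
  case 0
  have "tuples 0 n = (if n = 0 then {\<lambda>_. undefined} else {})"
    by (auto simp: tuples_def)
  then show ?case by simp
next
  case (Suc m)
  have less: "(\<Prod>i=1..m. fps_nth (f i) ((k(Suc m := j)) i)) = (\<Prod>i=1..m. fps_nth (f i) (k i))"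
    for j k by (rule prod.cong) auto
  have "fps_nth (\<Prod>i=1..Suc m. f i) n
      = (\<Sum>j\<le>n. fps_nth (f (Suc m)) j * fps_nth (\<Prod>i=1..m. f i) (n - j))"
    by (simp add: fps_mult_nth mult.commute[of "prod _ _"] atLeast0AtMost)
  also have "\<dots> = (\<Sum>j\<le>n. \<Sum>k\<in>tuples m (n - j). \<Prod>i=1..Suc m. fps_nth (f i) ((k(Suc m := j)) i))"
    unfolding Suc.IH sum_distrib_left
    by (intro sum.cong) (simp_all add: less mult.commute fun_upd_same del: fun_upd_apply One_nat_def)
  also have "\<dots> = (\<Sum>(j, k)\<in>(SIGMA j:{..n}. tuples m (n - j)).
      \<Prod>i=1..Suc m. fps_nth (f i) ((k(Suc m := j)) i))"
    by (rule sum.Sigma) (auto simp: finite_tuples)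
  also have "\<dots> = (\<Sum>k\<in>tuples (Suc m) n. \<Prod>i=1..Suc m. fps_nth (f i) (k i))"
    using sum.reindex_bij_betw[OF bij_betw_tuples_Suc,
      of "\<lambda>k. \<Prod>i=1..Suc m. fps_nth (f i) (k i)"] by (simp only: case_prod_unfold)
  finally show ?case .
qed

text \<open>Expanding the product means choosing the set \<open>S\<close> of factors that contribute
  their second term; such a choice has degree \<open>card S\<close> and sign
  \<open>(-1) ^ card S\<close>.\<close>

lemma fps_nth_prod_one_minus:
  fixes x :: "nat \<Rightarrow> 'a::comm_ring_1"
  shows "fps_nth (\<Prod>i=1..m. 1 - fps_const (x i) * fps_X) j = (-1) ^ j * esym j m x"
proof -
  let ?X = "fps_X :: 'a fps"
  have coeff: "fps_nth ((-1) ^ card S * (\<Prod>i\<in>S. fps_const (x i) * ?X)) j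
      = (if card S = j then (-1) ^ j * (\<Prod>i\<in>S. x i) else 0)" for S
  proof -
    have const: "(\<Prod>i\<in>S. fps_const (x i)) = fps_const (\<Prod>i\<in>S. x i)"
      by (induction S rule: infinite_finite_induct) simp_all
    have sign: "(-1 :: 'a fps) ^ k = fps_const ((-1) ^ k)" for k
      by (simp flip: fps_const_neg fps_const_power)
    have "(-1) ^ card S * (\<Prod>i\<in>S. fps_const (x i) * ?X)
        = fps_const ((-1) ^ card S * (\<Prod>i\<in>S. x i)) * ?X ^ card S"
      by (simp add: prod.distrib const sign mult.assoc flip: fps_const_mult)
    then show ?thesis by auto
  qed
  have "(\<Prod>i=1..m. 1 - fps_const (x i) * ?X)
      = (\<Sum>S\<in>Pow {1..m}. (-1) ^ card S * (\<Prod>i\<in>S. fps_const (x i) * ?X))"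
    by (simp add: prod_diff_conv_sum)
  then have "fps_nth (\<Prod>i=1..m. 1 - fps_const (x i) * ?X) j
      = (\<Sum>S\<in>Pow {1..m}. if card S = j then (-1) ^ j * (\<Prod>i\<in>S. x i) else 0)"
    by (simp only: fps_sum_nth coeff)
  also have "\<dots> = (\<Sum>S | S \<subseteq> {1..m} \<and> card S = j. (-1) ^ j * (\<Prod>i\<in>S. x i))"
    by (rule sum.mono_neutral_cong_right) auto
  finally show ?thesis by (simp add: esym_def sum_distrib_left)
qed

lemma esym_0 [simp]: "esym 0 m x = 1"
proof -
  have "{S. S \<subseteq> {1..m} \<and> card S = 0} = {{}}"
    by (auto simp: card_eq_0_iff dest: finite_subset)
  then show ?thesis by (simp add: esym_def)
qed

lemma esym_eq_0:
  assumes "j > m"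
  shows "esym j m x = 0"
proof -
  have "card S \<noteq> j" if "S \<subseteq> {1..m}" for S
    using card_mono[OF _ that] assms by simp
  then have "{S. S \<subseteq> {1..m} \<and> card S = j} = {}" by blast
  then show ?thesis unfolding esym_def by (simp only: sum.empty)
qed

lemma mconst_mult: "mconst (a * b) = mconst a * mconst (b :: 'a::field)"
  by (simp add: mconst_def mult_single)

lemma mconst_one [simp]: "mconst 1 = (1 :: 'a::field mpol)"
  by (simp add: mconst_def)

lemma mconst_diff: "mconst (a - b) = mconst a - mconst (b :: 'a::field)"
  by (simp add: mconst_def single_diff)

lemma mconst_minus: "mconst (- a) = - mconst (a :: 'a::field)"
  by (simp add: mconst_def single_uminus)

lemma mconst_power: "mconst (a ^ n) = mconst (a :: 'a::field) ^ n"
  by (induction n) (simp_all add: mconst_mult)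

lemma mconst_prod: "mconst (\<Prod>i\<in>A. f i) = (\<Prod>i\<in>A. mconst (f i :: 'a::field))"
  by (induction A rule: infinite_finite_induct) (simp_all add: mconst_mult)

text \<open>The series E(y X). Reciprocals are taken in the field and then embedded by
  \<open>mconst\<close>, since the polynomials only form a ring.\<close>

definition qexp :: "'a::field \<Rightarrow> 'a mpol \<Rightarrow> 'a mpol fps" where
  "qexp q y = Abs_fps (\<lambda>k. mconst (1 / qpoch q k) * y ^ k)"

lemma qpoch_Suc: "qpoch q (Suc k) = qpoch q k * (1 - q ^ Suc k)"
  by (simp add: qpoch_def)

lemma qpoch_nonzero: "\<forall>j\<in>{1..n}. q ^ j \<noteq> 1 \<Longrightarrow> qpoch q n \<noteq> 0"
  by (auto simp: qpoch_def)

text \<open>On coefficients this is q^k / (q)_k = 1 / (q)_k - 1 / (q)_(k-1), a rewriting of (q)_k =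
  (q)_(k-1) (1 - q^k). It breaks at the first k with (q)_k = 0, where division yields 0; hence the
  bound \<open>N\<close>.\<close>

lemma fps_scale_qexp:
  assumes "\<forall>j\<in>{1..N}. q ^ j \<noteq> 1"
  shows "fps_agree N (fps_scale (mconst q) (qexp q y)) ((1 - fps_const y * fps_X) * qexp q y)"
  unfolding fps_agree_def
proof (intro allI impI)
  fix n assume "n \<le> N"
  show "fps_nth (fps_scale (mconst q) (qexp q y)) n
      = fps_nth ((1 - fps_const y * fps_X) * qexp q y) n"
  proof (cases n)
    case 0
    then show ?thesis by (simp add: qexp_def)
  next
    case (Suc k)
    with assms \<open>n \<le> N\<close> have "qpoch q (Suc k) \<noteq> 0"
      by (intro qpoch_nonzero) auto
    then have "q ^ Suc k * (1 / qpoch q (Suc k)) = 1 / qpoch q (Suc k) - 1 / qpoch q k"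
      unfolding qpoch_Suc by (simp add: divide_simps)
    then have "mconst q ^ Suc k * mconst (1 / qpoch q (Suc k))
        = mconst (1 / qpoch q (Suc k)) - mconst (1 / qpoch q k)"
      by (simp only: flip: mconst_power mconst_mult mconst_diff)
    then have "mconst q ^ Suc k * (mconst (1 / qpoch q (Suc k)) * y ^ Suc k)
        = mconst (1 / qpoch q (Suc k)) * y ^ Suc k - y * (mconst (1 / qpoch q k) * y ^ k)"
      by (simp only: flip: mult.assoc) (simp add: algebra_simps)
    then show ?thesis
      by (simp add: Suc qexp_def left_diff_distrib mult.assoc del: power_Suc)
  qed
qed

lemma rogers_szego_eq_coeff:
  assumes "m \<ge> 1"
  shows "rogers_szego q m n = mconst (qpoch q n)
    * fps_nth (\<Prod>i=1..m. qexp q (if i = m then 1 else mvar i)) n"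
proof -
  let ?x = "\<lambda>i. if i = m then 1 else mvar i :: 'a mpol"
  have "mconst (qmultinomial q m n k) * (\<Prod>i=1..m-1. mvar i ^ k i)
      = mconst (qpoch q n) * (\<Prod>i=1..m. fps_nth (qexp q (?x i)) (k i))" for k
  proof -
    have "qmultinomial q m n k = qpoch q n * (\<Prod>i=1..m. 1 / qpoch q (k i))"
      by (simp add: qmultinomial_def prod_dividef)
    moreover have "(\<Prod>i=1..m-1. mvar i ^ k i) = (\<Prod>i=1..m. ?x i ^ k i)"
    proof -
      \<comment> \<open>The additional factor is \<open>1 ^ k m\<close>, so the product over
        \<open>m - 1\<close> variables extends to all \<open>m\<close> quantities.\<close>
      have "{1..m} = insert m {1..m-1}" using assms by auto
      moreover have "(\<Prod>i=1..m-1. mvar i ^ k i) = (\<Prod>i=1..m-1. ?x i ^ k i)"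
        by (rule prod.cong) auto
      ultimately show ?thesis using assms by simp
    qed
    ultimately show ?thesis
      by (simp add: qexp_def prod.distrib mconst_mult mconst_prod mult.assoc)
  qed
  then show ?thesis
    unfolding rogers_szego_def fps_nth_prod_tuples sum_distrib_left by simp
qed

theorem theorem2p2:
  fixes q :: "'a::field" and m n :: nat
  assumes "m \<ge> 2"
    and "\<forall>j\<in>{1..n+1}. q ^ j \<noteq> 1"
  shows "rogers_szego q m (n + 1) =
    (\<Sum>i=0..m-1. esym (i + 1) m (\<lambda>l. if l = m then 1 else mvar l)
       * mconst (qfall q n i) * rogers_szego q m (n - i))"
proof -
  define x :: "nat \<Rightarrow> 'a mpol" where "x = (\<lambda>l. if l = m then 1 else mvar l)"
  define P where "P = (\<Prod>l=1..m. qexp q (x l))"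
  define Q where "Q = (\<Prod>l=1..m. 1 - fps_const (x l) * fps_X)"
  have H: "rogers_szego q m k = mconst (qpoch q k) * fps_nth P k" for k
    using assms(1) by (simp add: rogers_szego_eq_coeff P_def x_def)
  have Q_nth: "fps_nth Q j = (-1) ^ j * esym j m x" for j
    unfolding Q_def by (rule fps_nth_prod_one_minus)
  have "fps_agree (n + 1) (fps_scale (mconst q) P) (Q * P)"
    unfolding P_def Q_def fps_scale_prod prod.distrib[symmetric]
    using assms(2) by (intro fps_agree_prod fps_scale_qexp)
  then have "mconst q ^ Suc n * fps_nth P (Suc n) = fps_nth (Q * P) (Suc n)"
    unfolding fps_agree_def fps_scale_nth by (metis Suc_eq_plus1 order_refl)
  \<comment> \<open>The constant coefficient of \<open>Q\<close> is 1. Its term is split off so that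
    it combines with the left-hand side into the factor 1 - q^(n+1).\<close>
  also have "\<dots> = fps_nth P (Suc n) + (\<Sum>i=0..n. fps_nth Q (Suc i) * fps_nth P (n - i))"
    unfolding fps_mult_nth sum.atLeast0_atMost_Suc_shift by (simp add: Q_nth)
  finally have rec: "(1 - mconst q ^ Suc n) * fps_nth P (Suc n)
      = (\<Sum>i=0..n. (-1) ^ i * esym (Suc i) m x * fps_nth P (n - i))"
    by (simp add: Q_nth left_diff_distrib sum_negf)
  \<comment> \<open>Trades the factor (q)_n for the (q)_(n-i) that turns the coefficient of
    \<open>P\<close> into a Rogers-Szego polynomial.\<close>
  have fall: "mconst (qpoch q n) * (-1) ^ i = mconst (qfall q n i) * mconst (qpoch q (n - i))"
    if "i \<le> n" for i
  proof -
    have "qpoch q (n - i) \<noteq> 0" using assms(2) by (intro qpoch_nonzero) auto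
    with that have "qpoch q n * (-1) ^ i = qfall q n i * qpoch q (n - i)"
      by (simp add: qfall_eq_quotient)
    then have "mconst (qpoch q n) * mconst (-1) ^ i = mconst (qfall q n i) * mconst (qpoch q (n - i))"
      by (simp only: flip: mconst_power mconst_mult)
    then show ?thesis by (simp add: mconst_minus)
  qed
  let ?t = "\<lambda>i. esym (i + 1) m x * mconst (qfall q n i) * rogers_szego q m (n - i)"
  \<comment> \<open>The factor 1 - q^(n+1) is exactly what completes (q)_n to (q)_(n+1).\<close>
  have "rogers_szego q m (n + 1) = mconst (qpoch q n) * ((1 - mconst q ^ Suc n) * fps_nth P (Suc n))"
    by (simp add: H qpoch_Suc mconst_mult mconst_diff mconst_power mult.assoc del: power_Suc)
  also have "\<dots> = (\<Sum>i=0..n. ?t i)"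
    unfolding rec sum_distrib_left
  proof (rule sum.cong)
    fix i assume "i \<in> {0..n}"
    then show "mconst (qpoch q n) * ((-1) ^ i * esym (Suc i) m x * fps_nth P (n - i)) = ?t i"
      using fall[of i] by (simp add: H flip: mult.assoc)
  qed simp
  \<comment> \<open>The Cauchy product stops at \<open>n\<close>, the claim at \<open>m - 1\<close>;
    \<open>n + m\<close> bounds both. Terms with i > n vanish through \<open>qfall\<close>, those
    with i \<ge> m through \<open>esym\<close>.\<close>
  also have "\<dots> = (\<Sum>i=0..n+m. ?t i)"
    by (rule sum.mono_neutral_left) (auto simp: qfall_eq_0 mconst_def)
  also have "\<dots> = (\<Sum>i=0..m-1. ?t i)"
    by (rule sum.mono_neutral_right) (auto simp: esym_eq_0)
  finally show ?thesis unfolding x_def .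
qed

end
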